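(* Let $\Gamma_1,\dots,\Gamma_k$ be graphs with $d$ vertices (loops and multiple edges allowed) and let $W_1\le S_d,\dots,W_k\le S_d$ be their automorphism groups, respectively. If $C(W_1,\dots,W_k)=\{((1),\dots,(1))\}$, then the number of all superpositions of $\Gamma_1,\dots,\Gamma_k$ is $$\frac{(d!)^{k-1}}{|W_1|\cdots|W_k|}.$$
   Context: $d,k\ge 1$; $S_d$ is the symmetric group with unit element $(1)$; $c_s(\sigma)$ is the number of cycles of length $s$ of $\sigma\in S_d$; $$C(W_1,\dots,W_k)=\{(\sigma_1,\dots,\sigma_k)\in W_1\times\cdots\times W_k\mid c_s(\sigma_1)=\cdots=c_s(\sigma_k)\text{ for }s=1,\dots,d\}.$$ The graphs have vertex set $\{1,\dots,d\}$, and the automorphism group of a graph is the group of vertex permutations preserving edge multiplicities. Superpositions of $\Gamma_1,\dots,\Gamma_k$ are the ways of placing the graphs on a common set of $d$ vertices, up to simultaneous relabelling of the vertices; that is, they are the equivalence classes of tuples $(a_1,\dots,a_k)\in S_d\times\cdots\times S_d$ (where $a_m$ represents the placed copy $a_m\Gamma_m$) under the relation $(a_1,\dots,a_k)\sim(b_1,\dots,b_k)$ iff there are $\zeta\in S_d$ and $w_m\in W_m$ with $b_m=\zeta a_mw_m$ for all $m$. *)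

theory Defs
  imports
    Complex_Main
    "HOL-Library.Uprod"
    "HOL-Library.Multiset"
    "HOL-Library.FuncSet"
    "HOL-Combinatorics.Orbits"
begin

text \<open>
  An undirected graph on the vertex set \<open>{1..d}\<close> with loops and multiple edges allowed is
  given by its multiset of edges; the unordered pair \<open>Upair v v\<close> is a loop at \<open>v\<close>.
\<close>

definition graph_on :: "nat \<Rightarrow> nat uprod multiset \<Rightarrow> bool" where
  "graph_on d G \<longleftrightarrow> (\<forall>e \<in># G. set_uprod e \<subseteq> {1..d})"

definition aut_group :: "nat \<Rightarrow> nat uprod multiset \<Rightarrow> (nat \<Rightarrow> nat) set" where
  "aut_group d G =
     {\<sigma>. \<sigma> permutes {1..d} \<and>
         (\<forall>u\<in>{1..d}. \<forall>v\<in>{1..d}. count G (Upair (\<sigma> u) (\<sigma> v)) = count G (Upair u v))}"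

text \<open>
  Cycles are identified with orbits, so a fixed point in \<open>{1..d}\<close> is a cycle of length 1.
\<close>

definition cycle_count :: "nat \<Rightarrow> nat \<Rightarrow> (nat \<Rightarrow> nat) \<Rightarrow> nat" where
  "cycle_count d s \<sigma> = card {c \<in> orbit \<sigma> ` {1..d}. card c = s}"

text \<open>
  A \<open>k\<close>-tuple is an extensional function on the index set \<open>{1..k}\<close>.
\<close>

definition same_cycle_tuples ::
    "nat \<Rightarrow> nat \<Rightarrow> (nat \<Rightarrow> (nat \<Rightarrow> nat) set) \<Rightarrow> (nat \<Rightarrow> nat \<Rightarrow> nat) set" where
  "same_cycle_tuples d k W =
     {\<sigma> \<in> (\<Pi>\<^sub>E m\<in>{1..k}. W m).
        \<forall>s\<in>{1..d}. \<forall>i\<in>{1..k}. \<forall>j\<in>{1..k}. cycle_count d s (\<sigma> i) = cycle_count d s (\<sigma> j)}"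

definition perm_tuples :: "nat \<Rightarrow> nat \<Rightarrow> (nat \<Rightarrow> nat \<Rightarrow> nat) set" where
  "perm_tuples d k = (\<Pi>\<^sub>E m\<in>{1..k}. {\<sigma>. \<sigma> permutes {1..d}})"

definition superposition_rel ::
    "nat \<Rightarrow> nat \<Rightarrow> (nat \<Rightarrow> nat uprod multiset) \<Rightarrow> (nat \<Rightarrow> nat \<Rightarrow> nat) rel" where
  "superposition_rel d k \<Gamma> =
     {(a, b). a \<in> perm_tuples d k \<and> b \<in> perm_tuples d k \<and>
        (\<exists>\<zeta> w. \<zeta> permutes {1..d} \<and>
           (\<forall>m\<in>{1..k}. w m \<in> aut_group d (\<Gamma> m) \<and> b m = \<zeta> \<circ> a m \<circ> w m))}"

definition superpositions ::
    "nat \<Rightarrow> nat \<Rightarrow> (nat \<Rightarrow> nat uprod multiset) \<Rightarrow> (nat \<Rightarrow> nat \<Rightarrow> nat) set set" where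
  "superpositions d k \<Gamma> = perm_tuples d k // superposition_rel d k \<Gamma>"

lemma id_in_aut_group: "id \<in> aut_group d G"
  by (simp add: aut_group_def permutes_id)

lemma comp_in_aut_group:
  assumes "\<sigma> \<in> aut_group d G" "\<tau> \<in> aut_group d G"
  shows "\<sigma> \<circ> \<tau> \<in> aut_group d G"
  using assms permutes_in_image[of \<tau> "{1..d}"]
  unfolding aut_group_def by (auto intro!: permutes_compose simp del: atLeastAtMost_iff)

lemma inv_in_aut_group:
  assumes "\<sigma> \<in> aut_group d G"
  shows "inv \<sigma> \<in> aut_group d G"
proof -
  have p: "\<sigma> permutes {1..d}"
    and c: "\<And>u v. u \<in> {1..d} \<Longrightarrow> v \<in> {1..d} \<Longrightarrow>
              count G (Upair (\<sigma> u) (\<sigma> v)) = count G (Upair u v)"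
    using assms by (auto simp: aut_group_def)
  have "count G (Upair (inv \<sigma> u) (inv \<sigma> v)) = count G (Upair u v)"
    if "u \<in> {1..d}" "v \<in> {1..d}" for u v
    using c[of "inv \<sigma> u" "inv \<sigma> v"] that permutes_in_image[OF permutes_inv[OF p]]
    by (simp add: permutes_inverses(1)[OF p])
  then show ?thesis
    using permutes_inv[OF p] by (auto simp: aut_group_def)
qed

lemma equiv_superposition_rel: "equiv (perm_tuples d k) (superposition_rel d k \<Gamma>)"
proof (rule equivI)
  show "superposition_rel d k \<Gamma> \<subseteq> perm_tuples d k \<times> perm_tuples d k"
    by (auto simp: superposition_rel_def)
  show "refl_on (perm_tuples d k) (superposition_rel d k \<Gamma>)"
    unfolding refl_on_def superposition_rel_def
    by (auto intro!: exI[of _ id] exI[of _ "\<lambda>_. id"] simp: permutes_id id_in_aut_group)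
  show "sym (superposition_rel d k \<Gamma>)"
  proof (rule symI)
    fix a b assume "(a, b) \<in> superposition_rel d k \<Gamma>"
    then obtain \<zeta> w where ab: "a \<in> perm_tuples d k" "b \<in> perm_tuples d k"
      and z: "\<zeta> permutes {1..d}"
      and w: "\<And>m. m \<in> {1..k} \<Longrightarrow> w m \<in> aut_group d (\<Gamma> m) \<and> b m = \<zeta> \<circ> a m \<circ> w m"
      unfolding superposition_rel_def by blast
    have "inv (w m) \<in> aut_group d (\<Gamma> m) \<and> a m = inv \<zeta> \<circ> b m \<circ> inv (w m)"
      if m: "m \<in> {1..k}" for m
    proof
      show "inv (w m) \<in> aut_group d (\<Gamma> m)"
        using w[OF m] inv_in_aut_group by blast
      have p: "w m permutes {1..d}"
        using w[OF m] by (simp add: aut_group_def)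
      show "a m = inv \<zeta> \<circ> b m \<circ> inv (w m)"
        using w[OF m] by (simp add: fun_eq_iff permutes_inverses[OF p] permutes_inverses[OF z])
    qed
    then show "(b, a) \<in> superposition_rel d k \<Gamma>"
      unfolding superposition_rel_def using ab permutes_inv[OF z]
      by (auto intro!: exI[of _ "inv \<zeta>"] exI[of _ "\<lambda>m. inv (w m)"])
  qed
  show "trans (superposition_rel d k \<Gamma>)"
  proof (rule transI)
    fix a b c
    assume 1: "(a, b) \<in> superposition_rel d k \<Gamma>" and 2: "(b, c) \<in> superposition_rel d k \<Gamma>"
    from 1 obtain \<zeta> w where a: "a \<in> perm_tuples d k"
      and z: "\<zeta> permutes {1..d}"
      and w: "\<And>m. m \<in> {1..k} \<Longrightarrow> w m \<in> aut_group d (\<Gamma> m) \<and> b m = \<zeta> \<circ> a m \<circ> w m"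
      unfolding superposition_rel_def by blast
    from 2 obtain \<xi> v where c: "c \<in> perm_tuples d k"
      and x: "\<xi> permutes {1..d}"
      and v: "\<And>m. m \<in> {1..k} \<Longrightarrow> v m \<in> aut_group d (\<Gamma> m) \<and> c m = \<xi> \<circ> b m \<circ> v m"
      unfolding superposition_rel_def by blast
    have "w m \<circ> v m \<in> aut_group d (\<Gamma> m) \<and> c m = (\<xi> \<circ> \<zeta>) \<circ> a m \<circ> (w m \<circ> v m)"
      if "m \<in> {1..k}" for m
      using w[OF that] v[OF that] comp_in_aut_group by (auto simp: comp_assoc)
    then show "(a, c) \<in> superposition_rel d k \<Gamma>"
      unfolding superposition_rel_def using a c permutes_compose[OF z x]
      by (auto intro!: exI[of _ "\<xi> \<circ> \<zeta>"] exI[of _ "\<lambda>m. w m \<circ> v m"])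
  qed
qed

end

theory Submission
  imports Defs
begin

text \<open>
  The group \<open>S\<^sub>d \<times> W\<^sub>1 \<times> \<dots> \<times> W\<^sub>k\<close> acts on \<open>S\<^sub>d \<times> \<dots> \<times> S\<^sub>d\<close>, and the superpositions are its orbits.
  If \<open>\<zeta> a\<^sub>m w\<^sub>m = \<zeta>' a\<^sub>m w'\<^sub>m\<close> for all \<open>m\<close>, then each \<open>w'\<^sub>m w\<^sub>m\<^sup>-\<^sup>1\<close> is conjugate, via \<open>a\<^sub>m\<close>,
  to the same permutation \<open>\<zeta>'\<^sup>-\<^sup>1 \<zeta>\<close>, so these elements have equal cycle counts and are trivial
  by hypothesis. Hence the action is free, and every orbit has \<open>d! |W\<^sub>1| \<cdots> |W\<^sub>k|\<close> elements.
\<close>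

text \<open>Orbits are generated inductively by forward iteration, and the intertwining equation
  turns each generating step for \<open>g\<close> into one for \<open>f\<close> and back. Induction
  therefore gives both inclusions.\<close>

lemma orbit_semiconj:
  assumes "\<And>x. f (a x) = a (g x)"
  shows "orbit f (a x) = a ` orbit g x"
proof
  show "orbit f (a x) \<subseteq> a ` orbit g x"
  proof
    fix y assume "y \<in> orbit f (a x)"
    then show "y \<in> a ` orbit g x"
      by induction (auto simp: assms intro: orbit.intros)
  qed
next
  have "a y \<in> orbit f (a x)" if "y \<in> orbit g x" for y
    using that by induction (auto simp: assms[symmetric] intro: orbit.intros)
  then show "a ` orbit g x \<subseteq> orbit f (a x)"
    by blast
qed

text \<open>Conjugation only relabels: \<open>image a\<close> preserves cardinalities, is injective
  on sets, and carries the cycles of \<open>g\<close> onto those of \<open>f\<close>.\<close>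

lemma cycle_count_conj:
  assumes a: "a permutes {1..d}" and conj: "\<And>x. f (a x) = a (g x)"
  shows "cycle_count d s f = cycle_count d s g"
proof -
  have inj: "inj a"
    using a by (rule permutes_inj)
  have "orbit f ` {1..d} = orbit f ` a ` {1..d}"
    by (simp only: permutes_image[OF a])
  also have "\<dots> = image a ` orbit g ` {1..d}"
    by (simp add: image_image orbit_semiconj[of f a g, OF conj])
  finally have "{c \<in> orbit f ` {1..d}. card c = s} =
      image a ` {c \<in> orbit g ` {1..d}. card c = s}"
    using inj by (auto simp: card_image[OF inj_on_subset[OF inj subset_UNIV]])
  moreover have "inj_on (image a) X" for X
    using inj by (auto intro!: inj_onI simp: inj_image_eq_iff)
  ultimately show ?thesis
    by (simp add: cycle_count_def card_image)
qed

lemma finite_aut_group: "finite (aut_group d G)"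
  by (rule finite_subset[of _ "{\<sigma>. \<sigma> permutes {1..d}}"])
    (auto simp: aut_group_def finite_permutations)

lemma aut_group_permutes: "\<sigma> \<in> aut_group d G \<Longrightarrow> \<sigma> permutes {1..d}"
  by (simp add: aut_group_def)

lemma finite_perm_tuples: "finite (perm_tuples d k)"
  by (auto simp: perm_tuples_def intro!: finite_PiE finite_permutations)

lemma card_perm_tuples: "card (perm_tuples d k) = fact d ^ k"
proof -
  have "card {\<sigma>. \<sigma> permutes {1..d}} = fact d"
    by (rule card_permutations) simp_all
  then show ?thesis
    unfolding perm_tuples_def by (subst card_PiE) simp_all
qed

text \<open>Presents a class as the image of a product of groups, so that its size follows once the
  orbit map is known to be injective.\<close>

lemma superposition_class_eq:
  assumes a: "a \<in> perm_tuples d k"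
  shows "superposition_rel d k \<Gamma> `` {a} =
    (\<lambda>(\<zeta>, w). \<lambda>m\<in>{1..k}. \<zeta> \<circ> a m \<circ> w m) `
      ({\<zeta>. \<zeta> permutes {1..d}} \<times> (\<Pi>\<^sub>E m\<in>{1..k}. aut_group d (\<Gamma> m)))"
    (is "?L = ?F ` ?X")
proof
  show "?L \<subseteq> ?F ` ?X"
  proof
    fix b assume "b \<in> ?L"
    then obtain \<zeta> w where b: "b \<in> perm_tuples d k" and \<zeta>: "\<zeta> permutes {1..d}"
      and w: "\<And>m. m \<in> {1..k} \<Longrightarrow> w m \<in> aut_group d (\<Gamma> m) \<and> b m = \<zeta> \<circ> a m \<circ> w m"
      unfolding superposition_rel_def by blast
    have ext: "b \<in> extensional {1..k}"
      using b by (simp add: perm_tuples_def PiE_def)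
    \<comment> \<open>The relation leaves \<open>w\<close> arbitrary outside \<open>{1..k}\<close>;
      restricting it gives an element of the extensional product.\<close>
    have "b = ?F (\<zeta>, restrict w {1..k})"
    proof (rule extensionalityI[OF ext])
      show "?F (\<zeta>, restrict w {1..k}) \<in> extensional {1..k}"
        by simp
    next
      fix m assume m: "m \<in> {1..k}"
      then show "b m = ?F (\<zeta>, restrict w {1..k}) m"
        using w[OF m] by simp
    qed
    moreover have "(\<zeta>, restrict w {1..k}) \<in> ?X"
      using \<zeta> w by auto
    ultimately show "b \<in> ?F ` ?X"
      by (rule image_eqI)
  qed
next
  have "?F (\<zeta>, w) \<in> ?L"
    if \<zeta>: "\<zeta> permutes {1..d}" and w: "w \<in> (\<Pi>\<^sub>E m\<in>{1..k}. aut_group d (\<Gamma> m))" for \<zeta> w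
  proof -
    have w': "w m \<in> aut_group d (\<Gamma> m)" if "m \<in> {1..k}" for m
      using w that by (rule PiE_mem)
    have "\<zeta> \<circ> a m \<circ> w m permutes {1..d}" if m: "m \<in> {1..k}" for m
    proof -
      have "a m permutes {1..d}"
        using a m unfolding perm_tuples_def by (auto dest: PiE_mem)
      then show ?thesis
        using \<zeta> aut_group_permutes[OF w'[OF m]] by (intro permutes_compose)
    qed
    then have "?F (\<zeta>, w) \<in> perm_tuples d k"
      by (simp add: perm_tuples_def)
    then show ?thesis
      using a \<zeta> w' unfolding superposition_rel_def
      by (auto intro!: exI[of _ \<zeta>] exI[of _ w])
  qed
  then show "?F ` ?X \<subseteq> ?L"
    by blast
qed

lemma superposition_action_free:
  assumes triv: "same_cycle_tuples d k (\<lambda>m. aut_group d (\<Gamma> m)) = {\<lambda>m\<in>{1..k}. id}"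
    and k: "k \<ge> 1" and a: "a \<in> perm_tuples d k"
  shows "inj_on (\<lambda>(\<zeta>, w). \<lambda>m\<in>{1..k}. \<zeta> \<circ> a m \<circ> w m)
      ({\<zeta>. \<zeta> permutes {1..d}} \<times> (\<Pi>\<^sub>E m\<in>{1..k}. aut_group d (\<Gamma> m)))"
proof (rule inj_onI, clarify)
  fix \<zeta> w \<zeta>' w'
  assume \<zeta>: "\<zeta> permutes {1..d}" and \<zeta>': "\<zeta>' permutes {1..d}"
    and w: "w \<in> (\<Pi>\<^sub>E m\<in>{1..k}. aut_group d (\<Gamma> m))"
    and w': "w' \<in> (\<Pi>\<^sub>E m\<in>{1..k}. aut_group d (\<Gamma> m))"
    and eq: "(\<lambda>m\<in>{1..k}. \<zeta> \<circ> a m \<circ> w m) = (\<lambda>m\<in>{1..k}. \<zeta>' \<circ> a m \<circ> w' m)"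
  have eqx: "\<zeta> (a m (w m x)) = \<zeta>' (a m (w' m x))" if "m \<in> {1..k}" for m x
    using fun_cong[OF fun_cong[OF eq, of m], of x] that by simp
  have wm: "w m \<in> aut_group d (\<Gamma> m)" "w' m \<in> aut_group d (\<Gamma> m)" if "m \<in> {1..k}" for m
    using w w' that by (auto dest: PiE_mem)
  have am: "a m permutes {1..d}" if "m \<in> {1..k}" for m
    using a that unfolding perm_tuples_def by (auto dest: PiE_mem)
  \<comment> \<open>\<open>\<tau> m\<close> is the conjugate by \<open>inv (a m)\<close> of
    \<open>inv \<zeta>' \<circ> \<zeta>\<close>, a permutation that does not depend on
    \<open>m\<close>; this is what forces equal cycle counts.\<close>
  define \<tau> where "\<tau> = (\<lambda>m\<in>{1..k}. w' m \<circ> inv (w m))"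
  have conj: "(inv \<zeta>' \<circ> \<zeta>) (a m x) = a m (\<tau> m x)" if m: "m \<in> {1..k}" for m x
  proof -
    have "\<zeta> (a m x) = \<zeta>' (a m (\<tau> m x))"
      using eqx[OF m, of "inv (w m) x"] m
      by (simp add: \<tau>_def permutes_inverses[OF aut_group_permutes[OF wm(1)[OF m]]])
    then show ?thesis
      by (simp add: permutes_inverses[OF \<zeta>'])
  qed
  have "cycle_count d s (\<tau> m) = cycle_count d s (inv \<zeta>' \<circ> \<zeta>)" if "m \<in> {1..k}" for m s
    using cycle_count_conj[of "a m" d "inv \<zeta>' \<circ> \<zeta>" "\<tau> m" s] am conj that by simp
  moreover have "\<tau> \<in> (\<Pi>\<^sub>E m\<in>{1..k}. aut_group d (\<Gamma> m))"
    using wm comp_in_aut_group inv_in_aut_group by (auto simp: \<tau>_def)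
  ultimately have "\<tau> \<in> same_cycle_tuples d k (\<lambda>m. aut_group d (\<Gamma> m))"
    by (simp add: same_cycle_tuples_def)
  then have \<tau>: "\<tau> = (\<lambda>m\<in>{1..k}. id)"
    using triv by simp
  have \<tau>_id: "\<tau> m x = x" if "m \<in> {1..k}" for m x
    using that by (simp add: \<tau>)
  have "w m = w' m" if m: "m \<in> {1..k}" for m
  proof
    fix x
    show "w m x = w' m x"
      using \<tau>_id[OF m, of "w m x"] m
      by (simp add: \<tau>_def permutes_inverses[OF aut_group_permutes[OF wm(1)[OF m]]])
  qed
  then have "w = w'"
    by (rule PiE_ext[OF w w'])
  moreover have "\<zeta> = \<zeta>'"
  proof
    fix x
    \<comment> \<open>One index suffices to recover \<open>\<zeta>\<close>: there
      \<open>inv \<zeta>' \<circ> \<zeta>\<close> is conjugate to the identity, hence is the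
      identity.\<close>
    have 1: "1 \<in> {1..k}"
      using k by simp
    have "inv \<zeta>' (\<zeta> x) = x"
      using conj[OF 1, of "inv (a 1) x"]
      unfolding \<tau>_id[OF 1] permutes_inverses(1)[OF am[OF 1]] by simp
    then show "\<zeta> x = \<zeta>' x"
      by (metis permutes_inverses(1)[OF \<zeta>'])
  qed
  ultimately show "\<zeta> = \<zeta>' \<and> w = w'"
    by simp
qed

lemma card_superposition_class:
  assumes "same_cycle_tuples d k (\<lambda>m. aut_group d (\<Gamma> m)) = {\<lambda>m\<in>{1..k}. id}"
    and "k \<ge> 1" and "a \<in> perm_tuples d k"
  shows "card (superposition_rel d k \<Gamma> `` {a}) = fact d * (\<Prod>m=1..k. card (aut_group d (\<Gamma> m)))"
proof -
  have "card {\<sigma>. \<sigma> permutes {1..d}} = fact d"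
    by (rule card_permutations) simp_all
  then show ?thesis
    unfolding superposition_class_eq[OF assms(3)] card_image[OF superposition_action_free[OF assms]]
      card_cartesian_product
    by (subst card_PiE) simp_all
qed

text \<open>The classes partition all tuples into blocks of the common size just computed. The
  product form keeps the count in the natural numbers, without division.\<close>

lemma card_superpositions:
  assumes "same_cycle_tuples d k (\<lambda>m. aut_group d (\<Gamma> m)) = {\<lambda>m\<in>{1..k}. id}"
    and "k \<ge> 1"
  shows "fact d * (\<Prod>m=1..k. card (aut_group d (\<Gamma> m))) * card (superpositions d k \<Gamma>) = fact d ^ k"
proof -
  note E = equiv_superposition_rel[of d k \<Gamma>]
  have U: "\<Union> (superpositions d k \<Gamma>) = perm_tuples d k"
    unfolding superpositions_def by (rule Union_quotient[OF E])
  have "fact d * (\<Prod>m=1..k. card (aut_group d (\<Gamma> m))) * card (superpositions d k \<Gamma>) =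
      card (\<Union> (superpositions d k \<Gamma>))"
  proof (rule card_partition)
    show "finite (\<Union> (superpositions d k \<Gamma>))"
      by (simp add: U finite_perm_tuples)
    then show "finite (superpositions d k \<Gamma>)"
      by (rule finite_UnionD)
    show "card c = fact d * (\<Prod>m=1..k. card (aut_group d (\<Gamma> m)))"
      if "c \<in> superpositions d k \<Gamma>" for c
      using that card_superposition_class[OF assms]
      unfolding superpositions_def by (auto elim!: quotientE)
    show "c \<inter> c' = {}"
      if "c \<in> superpositions d k \<Gamma>" "c' \<in> superpositions d k \<Gamma>" "c \<noteq> c'" for c c'
      using that quotient_disj[OF E] unfolding superpositions_def by blast
  qed
  then show ?thesis
    by (simp add: U card_perm_tuples)
qed

theorem corollary3p1p1:
  fixes d k :: nat
    and \<Gamma> :: "nat \<Rightarrow> nat uprod multiset"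
    and W :: "nat \<Rightarrow> (nat \<Rightarrow> nat) set"
  assumes "d \<ge> 1" and "k \<ge> 1"
    and "\<And>m. m \<in> {1..k} \<Longrightarrow> graph_on d (\<Gamma> m)"
    and "\<And>m. m \<in> {1..k} \<Longrightarrow> W m = aut_group d (\<Gamma> m)"
    and "same_cycle_tuples d k W = {\<lambda>m\<in>{1..k}. id}"
  shows "real (card (superpositions d k \<Gamma>)) = fact d ^ (k - 1) / (\<Prod>m=1..k. real (card (W m)))"
proof -
  let ?P = "\<Prod>m=1..k. card (aut_group d (\<Gamma> m))"
  \<comment> \<open>\<open>W\<close> is known only on \<open>{1..k}\<close>, so the tuple sets are
    identified instead of the functions \<open>W\<close> and
    \<open>\<lambda>m. aut_group d (\<Gamma> m)\<close>.\<close>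
  have "(\<Pi>\<^sub>E m\<in>{1..k}. W m) = (\<Pi>\<^sub>E m\<in>{1..k}. aut_group d (\<Gamma> m))"
    using assms(4) by (rule PiE_cong)
  then have "same_cycle_tuples d k (\<lambda>m. aut_group d (\<Gamma> m)) = {\<lambda>m\<in>{1..k}. id}"
    using assms(5) by (simp add: same_cycle_tuples_def)
  then have "fact d * ?P * card (superpositions d k \<Gamma>) = fact d ^ k"
    using \<open>k \<ge> 1\<close> by (rule card_superpositions)
  \<comment> \<open>Splitting off one \<open>fact d\<close> allows cancelling the order of the group
    of relabellings \<open>\<zeta>\<close>.\<close>
  also have "\<dots> = fact d * fact d ^ (k - 1)"
    using \<open>k \<ge> 1\<close> by (cases k) simp_all
  finally have "?P * card (superpositions d k \<Gamma>) = fact d ^ (k - 1)"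
    by (simp add: mult.assoc)
  then have "real ?P * real (card (superpositions d k \<Gamma>)) = fact d ^ (k - 1)"
    by (metis of_nat_fact of_nat_mult of_nat_power)
  \<comment> \<open>A finite group containing \<open>id\<close> has nonzero order, so the real
    quotient is a genuine division.\<close>
  moreover have "card (aut_group d (\<Gamma> m)) \<noteq> 0" for m
    using finite_aut_group[of d "\<Gamma> m"] id_in_aut_group[of d "\<Gamma> m"] by (auto simp: card_eq_0_iff)
  then have "real ?P \<noteq> 0"
    by simp
  moreover have "(\<Prod>m=1..k. real (card (W m))) = real ?P"
    unfolding of_nat_prod using assms(4) by (intro prod.cong) auto
  ultimately show ?thesis
    by (simp add: field_simps)
qed

end
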